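(* Let $X=(X_1,\ldots,X_N)$ be a family of independent random variables with $X_k$ taking values in a set $\Lambda_k$. Let $\Gamma\subseteq\prod_{j\in[N]}\Lambda_j$ be an event and let $f:\prod_{j\in[N]}\Lambda_j\to\mathbb{R}$ be a function. Assume that there are numbers $(c_k)_{k\in[N]}$ and $(d_k)_{k\in[N]}$ with $c_k\le d_k$ such that whenever $x,\tilde x\in\prod_{j\in[N]}\Lambda_j$ differ only in the $k$-th coordinate we have $$|f(x)-f(\tilde x)|\le\begin{cases}c_k&\text{if }x\in\Gamma,\\ d_k&\text{otherwise.}\end{cases}$$ Then for any numbers $(\gamma_k)_{k\in[N]}$ with $\gamma_k\in(0,1]$ there is an event $\mathcal{B}=\mathcal{B}(\Gamma,(\gamma_k)_{k\in[N]})$ satisfying $$\mathbb{P}(\mathcal{B})\le\sum_{k\in[N]}\gamma_k^{-1}\cdot\mathbb{P}(X\notin\Gamma)\quad\text{and}\quad\neg\mathcal{B}\subseteq\Gamma,$$ such that for $\mu=\mathbb{E}f(X)$, $e_k=\gamma_k(d_k-c_k)$ and any $t\ge0$ we have $$\mathbb{P}(f(X)\ge\mu+t\text{ and }\neg\mathcal{B})\le\exp\left(-\frac{t^2}{2\sum_{k\in[N]}(c_k+e_k)^2}\right).$$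
   Context: $[N]=\{1,\ldots,N\}$. Each $\Lambda_k$ is a measurable space, $\Gamma$ is a measurable subset of the product and $f$ is measurable, so that $\mathbb{P}(X\notin\Gamma)$ and $\mathbb{E}f(X)$ make sense. An event such as $\mathcal{B}$ or $\Gamma$ is identified with a subset of $\prod_{j\in[N]}\Lambda_j$; $\mathbb{P}(\mathcal{B})=\mathbb{P}(X\in\mathcal{B})$ and $\neg\mathcal{B}$ is the complement. The notation $\mathcal{B}=\mathcal{B}(\Gamma,(\gamma_k)_{k\in[N]})$ means that $\mathcal{B}$ depends only on $\Gamma$ and $(\gamma_k)$ (and the law of $X$), not on $f$ or $t$. *)

theory Defs
  imports "HOL-Probability.Probability"
begin

text \<open>The family \<open>X = (X_1, \<dots>, X_N)\<close> as a random element of \<open>PiM {1..N} L\<close>,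
  where the measurable space \<open>L k\<close> plays the role of \<open>\<Lambda>_k\<close>. Only the space and the
  sigma-algebra of \<open>L k\<close> matter; the measure it carries is ignored by \<open>PiM\<close>-measurability and by
  \<open>indep_vars\<close>.\<close>

definition joint :: "nat \<Rightarrow> (nat \<Rightarrow> 'a \<Rightarrow> 'b) \<Rightarrow> 'a \<Rightarrow> nat \<Rightarrow> 'b" where
  "joint N X \<omega> = (\<lambda>k\<in>{1..N}. X k \<omega>)"

text \<open>Events \<open>\<Gamma>\<close> and their complements live in \<open>space (PiM {1..N} L)\<close>, whose points are
  extensional functions; hence the index \<open>j\<close> below can range over all naturals.\<close>

definition differ_only_at :: "nat \<Rightarrow> (nat \<Rightarrow> 'b) \<Rightarrow> (nat \<Rightarrow> 'b) \<Rightarrow> bool" where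
  "differ_only_at k x y \<longleftrightarrow> x k \<noteq> y k \<and> (\<forall>j. j \<noteq> k \<longrightarrow> x j = y j)"

definition typical_bounded_differences ::
  "nat \<Rightarrow> (nat \<Rightarrow> 'b measure) \<Rightarrow> (nat \<Rightarrow> 'b) set \<Rightarrow> ((nat \<Rightarrow> 'b) \<Rightarrow> real)
    \<Rightarrow> (nat \<Rightarrow> real) \<Rightarrow> (nat \<Rightarrow> real) \<Rightarrow> bool" where
  "typical_bounded_differences N L \<Gamma> f c d \<longleftrightarrow>
    (\<forall>k\<in>{1..N}. \<forall>x\<in>space (PiM {1..N} L). \<forall>y\<in>space (PiM {1..N} L).
      differ_only_at k x y \<longrightarrow> \<bar>f x - f y\<bar> \<le> (if x \<in> \<Gamma> then c k else d k))"

text \<open>The bound \<open>exp (- t\<^sup>2 / (2 s))\<close> for \<open>s \<ge> 0\<close>. Since \<open>x / 0 = 0\<close> in HOL, the plain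
  expression would degenerate to \<open>1\<close> at \<open>s = 0\<close>; for \<open>t > 0\<close> the limiting value
  \<open>exp (- \<infinity>) = 0\<close> is used instead. At \<open>s = t = 0\<close> the value is \<open>1\<close>.\<close>

definition exp_tail :: "real \<Rightarrow> real \<Rightarrow> real" where
  "exp_tail s t = (if s = 0 \<and> 0 < t then 0 else exp (- (t\<^sup>2 / (2 * s))))"

end

theory Submission
  imports Defs
begin

text \<open>Let \<open>E\<^sub>k f\<close> be the mean of \<open>f\<close> given the first \<open>k\<close> coordinates. Resampling coordinate
  \<open>k\<close> changes \<open>f\<close> by at most \<open>c\<^sub>k\<close> when the resampled point lies in \<open>\<Gamma>\<close> and by at most \<open>d\<^sub>k\<close>
  otherwise, so \<open>\<bar>E\<^sub>k f - E\<^sub>k\<^sub>-\<^sub>1 f\<bar> \<le> c\<^sub>k + (d\<^sub>k - c\<^sub>k) q\<^sub>k\<close>, where \<open>q\<^sub>k\<close> is the probability of leaving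
  \<open>\<Gamma>\<close> given the first \<open>k - 1\<close> coordinates. This is at most \<open>c\<^sub>k + e\<^sub>k\<close> unless \<open>q\<^sub>k > \<gamma>\<^sub>k\<close>, an event of
  probability at most \<open>\<P>(X \<notin> \<Gamma>) / \<gamma>\<^sub>k\<close> by Markov. Since that event depends only on
  the first \<open>k - 1\<close> coordinates, replacing the difference by \<open>0\<close> there leaves a martingale with
  bounded differences, to which the Azuma--Hoeffding argument applies.\<close>

section \<open>Optimising the Chernoff bound\<close>

text \<open>For \<open>s > 0\<close> the exponent is smallest at \<open>l = t / s\<close>. For
  \<open>s = 0 < t\<close> letting \<open>l\<close> grow drives the bound to 0, the value that
  \<open>exp_tail\<close> takes there.\<close>

lemma le_exp_tailI:
  fixes p s t :: real
  assumes "0 \<le> s" "0 \<le> t" "p \<le> 1"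
    and chernoff: "\<And>l. 0 < l \<Longrightarrow> p \<le> exp (l\<^sup>2 * s / 2 - l * t)"
  shows "p \<le> exp_tail s t"
proof (cases "t = 0")
  case True
  then show ?thesis using assms by (simp add: exp_tail_def)
next
  case False
  with assms have t: "0 < t" by simp
  show ?thesis
  proof (cases "s = 0")
    case True
    have "p \<le> 0"
    proof (rule field_le_epsilon)
      fix e :: real assume e: "0 < e"
      \<comment> \<open>At \<open>s = 0\<close> the hypothesis reads
        \<open>p \<le> exp (- (l * t))\<close>; this \<open>l\<close> brings the right side down to
        at most \<open>e\<close>.\<close>
      define l where "l = (\<bar>ln e\<bar> + 1) / t"
      have l: "0 < l" using t by (simp add: l_def)
      have "l * t = \<bar>ln e\<bar> + 1" using t by (simp add: l_def)
      then have "p \<le> exp (- (\<bar>ln e\<bar> + 1))"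
        using chernoff[OF l] True by simp
      also have "\<dots> \<le> exp (ln e)" by simp
      finally show "p \<le> 0 + e" using e by simp
    qed
    then show ?thesis using True t by (simp add: exp_tail_def)
  next
    case False
    with assms have s: "0 < s" by simp
    have "(t / s)\<^sup>2 * s / 2 - t / s * t = - (t\<^sup>2 / (2 * s))"
      using s by (simp add: field_simps power2_eq_square)
    then show ?thesis
      using chernoff[of "t / s"] s t by (simp add: exp_tail_def)
  qed
qed

section \<open>Splicing two points at an index\<close>

text \<open>Averaging over \<open>y\<close> under a product measure turns this splice into
  conditioning on the first \<open>k\<close> coordinates of \<open>x\<close>.\<close>

definition resample :: "nat \<Rightarrow> (nat \<Rightarrow> 'b) \<Rightarrow> (nat \<Rightarrow> 'b) \<Rightarrow> nat \<Rightarrow> 'b" where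
  "resample k x y = (\<lambda>i. if i \<le> k then x i else y i)"

lemma resample_cong: "(\<And>i. i \<le> k \<Longrightarrow> x i = x' i) \<Longrightarrow> resample k x y = resample k x' y"
  by (auto simp: resample_def)

text \<open>Consecutive splices differ at most in coordinate \<open>k\<close>, so the
  bounded-difference hypothesis can compare them.\<close>

lemma resample_eq_fun_upd:
  "1 \<le> k \<Longrightarrow> resample k x y = (resample (k - 1) x y)(k := x k)"
  by (auto simp: resample_def fun_eq_iff)

text \<open>The fresh value moves from the fixed point to the averaged one, where integrating over
  it completes a draw from the product; \<open>cond_mean_tower\<close> rests on this.\<close>

lemma resample_fun_upd:
  "1 \<le> k \<Longrightarrow> resample k (x(k := z)) y = resample (k - 1) x (y(k := z))"
  by (auto simp: resample_def fun_eq_iff)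

text \<open>Otherwise the simplifier turns \<open>{1..N}\<close> into \<open>{Suc 0..N}\<close>, and the facts about the
  product measure below no longer match.\<close>

declare One_nat_def [simp del]

section \<open>Product probability spaces and resampling of one coordinate\<close>

locale product_prob_seq =
  fixes P :: "nat \<Rightarrow> 'b measure" and N :: nat
  assumes prob_space_component: "\<And>k. prob_space (P k)"
begin

abbreviation Q :: "(nat \<Rightarrow> 'b) measure" where "Q \<equiv> PiM {1..N} P"

sublocale M: prob_space "P k" for k
  by (rule prob_space_component)

sublocale S: product_sigma_finite P ..

sublocale Q: prob_space Q
  by (intro prob_space_PiM prob_space_component)

lemma fun_upd_in_space:
  "\<lbrakk>k \<in> {1..N}; x \<in> space Q; z \<in> space (P k)\<rbrakk> \<Longrightarrow> x(k := z) \<in> space Q"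
  by (auto simp: space_PiM PiE_def Pi_def extensional_def)

lemma resample_in_space: "\<lbrakk>x \<in> space Q; y \<in> space Q\<rbrakk> \<Longrightarrow> resample k x y \<in> space Q"
  by (auto simp: space_PiM PiE_def Pi_def extensional_def resample_def)

text \<open>Coordinate 0 and those beyond \<open>N\<close> lie outside the index set, where all
  points of \<open>space Q\<close> are \<open>undefined\<close>. Hence the splice at 0 keeps all of
  \<open>y\<close>, and below the splice at \<open>N\<close> keeps all of \<open>x\<close>.\<close>

lemma resample_0: "\<lbrakk>x \<in> space Q; y \<in> space Q\<rbrakk> \<Longrightarrow> resample 0 x y = y"
  by (auto simp: space_PiM PiE_def extensional_def resample_def fun_eq_iff)

lemma resample_full: "\<lbrakk>x \<in> space Q; y \<in> space Q\<rbrakk> \<Longrightarrow> resample N x y = x"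
  by (auto simp: space_PiM PiE_def extensional_def resample_def fun_eq_iff)

lemma measurable_fun_upd_pair:
  assumes k: "k \<in> {1..N}"
  shows "(\<lambda>(x, z). x(k := z)) \<in> measurable (Q \<Otimes>\<^sub>M P k) Q"
proof -
  have "insert k {1..N} = {1..N}" using k by auto
  then show ?thesis using measurable_add_dim[of k "{1..N}" P] by simp
qed

lemma measurable_fun_upd_component:
  assumes k: "k \<in> {1..N}" and x: "x \<in> space Q"
  shows "(\<lambda>z. x(k := z)) \<in> measurable (P k) Q"
  using measurable_compose[OF measurable_Pair1'[OF x] measurable_fun_upd_pair[OF k]] by simp

lemma measurable_resample_pair:
  "(\<lambda>(x, y). resample k x y) \<in> measurable (Q \<Otimes>\<^sub>M Q) Q"
proof -
  have "(\<lambda>p i. if i \<le> k then fst p i else snd p i) \<in> measurable (Q \<Otimes>\<^sub>M Q) Q"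
  proof (rule measurable_PiM_single')
    fix i assume i: "i \<in> {1..N}"
    show "(\<lambda>p. if i \<le> k then fst p i else snd p i) \<in> measurable (Q \<Otimes>\<^sub>M Q) (P i)"
      using i by (cases "i \<le> k") auto
  next
    show "(\<lambda>p i. if i \<le> k then fst p i else snd p i) \<in> space (Q \<Otimes>\<^sub>M Q) \<rightarrow> (\<Pi>\<^sub>E i\<in>{1..N}. space (P i))"
      by (auto simp: space_pair_measure space_PiM PiE_def Pi_def extensional_def)
  qed
  then show ?thesis by (simp add: resample_def case_prod_beta')
qed

lemma measurable_resample:
  assumes x: "x \<in> space Q"
  shows "(\<lambda>y. resample k x y) \<in> measurable Q Q"
  using measurable_compose[OF measurable_Pair1'[OF x] measurable_resample_pair] by simp

text \<open>A product measure is determined by boxes. The preimage of a box is the box with side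
  \<open>k\<close> freed, times \<open>A k\<close>: the freed side has mass 1, and
  \<open>A k\<close> restores the missing factor.\<close>

lemma distr_fun_upd:
  assumes k: "k \<in> {1..N}"
  shows "distr (Q \<Otimes>\<^sub>M P k) Q (\<lambda>(x, z). x(k := z)) = Q"
proof (rule S.PiM_eqI)
  fix A assume A: "\<And>i. i \<in> {1..N} \<Longrightarrow> A i \<in> sets (P i)"
  define A' where "A' = A(k := space (P k))"
  have A': "\<And>i. i \<in> {1..N} \<Longrightarrow> A' i \<in> sets (P i)"
    using A by (auto simp: A'_def)
  have "(\<lambda>(x, z). x(k := z)) -` Pi\<^sub>E {1..N} A \<inter> space (Q \<Otimes>\<^sub>M P k) = Pi\<^sub>E {1..N} A' \<times> A k"
    (is "?l = ?r")
  proof (intro set_eqI iffI)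
    fix p assume p: "p \<in> ?l"
    obtain x z where xz: "p = (x, z)" by (cases p)
    have "x \<in> space Q" "z \<in> space (P k)" "x(k := z) \<in> Pi\<^sub>E {1..N} A"
      using p by (auto simp: xz space_pair_measure)
    then show "p \<in> ?r"
      using k by (auto simp: xz A'_def space_PiM PiE_def Pi_def extensional_def split: if_splits)
  next
    fix p assume p: "p \<in> ?r"
    obtain x z where xz: "p = (x, z)" by (cases p)
    have x: "x \<in> Pi\<^sub>E {1..N} A'" and z: "z \<in> A k" using p by (auto simp: xz)
    have "x \<in> space Q" "z \<in> space (P k)"
      using x z A'[THEN sets.sets_into_space] A[OF k, THEN sets.sets_into_space]
      by (auto simp: space_PiM PiE_def Pi_def)
    moreover have "x(k := z) \<in> Pi\<^sub>E {1..N} A"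
      using x z k by (auto simp: A'_def PiE_def Pi_def extensional_def split: if_splits)
    ultimately show "p \<in> ?l" by (simp add: xz space_pair_measure)
  qed
  then have "emeasure (distr (Q \<Otimes>\<^sub>M P k) Q (\<lambda>(x, z). x(k := z))) (Pi\<^sub>E {1..N} A)
      = emeasure (Q \<Otimes>\<^sub>M P k) (Pi\<^sub>E {1..N} A' \<times> A k)"
    using A by (subst emeasure_distr[OF measurable_fun_upd_pair[OF k]]) (auto intro: sets_PiM_I_finite)
  also have "\<dots> = emeasure Q (Pi\<^sub>E {1..N} A') * emeasure (P k) (A k)"
    using A A' k by (intro M.emeasure_pair_measure_Times) (auto intro: sets_PiM_I_finite)
  also have "emeasure Q (Pi\<^sub>E {1..N} A') = (\<Prod>i\<in>{1..N}. emeasure (P i) (A' i))"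
    using A' by (intro S.emeasure_PiM) auto
  also have "\<dots> = emeasure (P k) (A' k) * (\<Prod>i\<in>{1..N}-{k}. emeasure (P i) (A' i))"
    using k by (intro prod.remove) auto
  also have "\<dots> = (\<Prod>i\<in>{1..N}-{k}. emeasure (P i) (A i))"
    by (simp add: A'_def M.emeasure_space_1)
  also have "\<dots> * emeasure (P k) (A k) = (\<Prod>i\<in>{1..N}. emeasure (P i) (A i))"
    using k prod.remove[of "{1..N}" k "\<lambda>i. emeasure (P i) (A i)"] by (simp add: mult.commute)
  finally show "emeasure (distr (Q \<Otimes>\<^sub>M P k) Q (\<lambda>(x, z). x(k := z))) (Pi\<^sub>E {1..N} A)
      = (\<Prod>i\<in>{1..N}. emeasure (P i) (A i))" .
qed auto

lemma nn_integral_fun_upd: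
  assumes k: "k \<in> {1..N}" and g: "(g :: _ \<Rightarrow> ennreal) \<in> borel_measurable Q"
  shows "(\<integral>\<^sup>+x. g x \<partial>Q) = (\<integral>\<^sup>+x. (\<integral>\<^sup>+z. g (x(k := z)) \<partial>P k) \<partial>Q)"
proof -
  have "(\<integral>\<^sup>+x. g x \<partial>Q) = (\<integral>\<^sup>+x. g x \<partial>distr (Q \<Otimes>\<^sub>M P k) Q (\<lambda>(x, z). x(k := z)))"
    by (simp only: distr_fun_upd[OF k])
  also have "\<dots> = (\<integral>\<^sup>+p. g ((\<lambda>(x, z). x(k := z)) p) \<partial>(Q \<Otimes>\<^sub>M P k))"
    by (rule nn_integral_distr[OF measurable_fun_upd_pair[OF k]]) (simp add: g)
  also have "\<dots> = (\<integral>\<^sup>+x. (\<integral>\<^sup>+z. g (x(k := z)) \<partial>P k) \<partial>Q)"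
    by (subst M.nn_integral_fst[symmetric])
      (use measurable_compose[OF measurable_fun_upd_pair[OF k] g] in simp_all)
  finally show ?thesis .
qed

lemma integrable_bounded:
  fixes f :: "(nat \<Rightarrow> 'b) \<Rightarrow> real"
  assumes "f \<in> borel_measurable Q" "\<And>x. x \<in> space Q \<Longrightarrow> \<bar>f x\<bar> \<le> K"
  shows "integrable Q f"
  using assms by (intro Q.integrable_const_bound[where B = K]) auto

text \<open>Fubini on the pair space, where boundedness supplies integrability. The first order of
  integration serves \<open>integral_cond_mean\<close>, the second
  \<open>cond_mean_tower\<close>.\<close>

lemma integral_fun_upd:
  fixes f :: "(nat \<Rightarrow> 'b) \<Rightarrow> real"
  assumes k: "k \<in> {1..N}" and f: "f \<in> borel_measurable Q"
    and bd: "\<And>x. x \<in> space Q \<Longrightarrow> \<bar>f x\<bar> \<le> K"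
  shows "(\<integral>x. f x \<partial>Q) = (\<integral>x. (\<integral>z. f (x(k := z)) \<partial>P k) \<partial>Q)"
    and "(\<integral>x. f x \<partial>Q) = (\<integral>z. (\<integral>x. f (x(k := z)) \<partial>Q) \<partial>P k)"
proof -
  interpret R: pair_prob_space Q "P k" ..
  have m: "(\<lambda>p. f ((\<lambda>(x, z). x(k := z)) p)) \<in> borel_measurable (Q \<Otimes>\<^sub>M P k)"
    by (rule measurable_compose[OF measurable_fun_upd_pair[OF k] f])
  have int: "integrable (Q \<Otimes>\<^sub>M P k) (\<lambda>(x, z). f (x(k := z)))"
    using m bd fun_upd_in_space[OF k]
    by (intro R.integrable_const_bound[where B = K])
      (auto simp: space_pair_measure case_prod_beta' intro!: AE_I2)
  have "(\<integral>x. f x \<partial>Q) = (\<integral>x. f x \<partial>distr (Q \<Otimes>\<^sub>M P k) Q (\<lambda>(x, z). x(k := z)))"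
    by (simp only: distr_fun_upd[OF k])
  also have "\<dots> = (\<integral>p. f ((\<lambda>(x, z). x(k := z)) p) \<partial>(Q \<Otimes>\<^sub>M P k))"
    by (rule integral_distr[OF measurable_fun_upd_pair[OF k]]) (simp add: f)
  finally have eq: "(\<integral>x. f x \<partial>Q) = (\<integral>(x, z). f (x(k := z)) \<partial>(Q \<Otimes>\<^sub>M P k))"
    by (simp add: case_prod_beta')
  show "(\<integral>x. f x \<partial>Q) = (\<integral>x. (\<integral>z. f (x(k := z)) \<partial>P k) \<partial>Q)"
    unfolding eq by (subst R.integral_fst'[symmetric, OF int]) simp
  show "(\<integral>x. f x \<partial>Q) = (\<integral>z. (\<integral>x. f (x(k := z)) \<partial>Q) \<partial>P k)"
    unfolding eq by (rule R.integral_snd[symmetric, OF int])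
qed

section \<open>Conditional means given the initial coordinates\<close>

text \<open>An explicit version of the conditional expectation, so that the martingale facts below
  hold at every point and not merely almost everywhere.\<close>

definition cond_mean :: "nat \<Rightarrow> ((nat \<Rightarrow> 'b) \<Rightarrow> real) \<Rightarrow> (nat \<Rightarrow> 'b) \<Rightarrow> real" where
  "cond_mean k f x = (\<integral>y. f (resample k x y) \<partial>Q)"

lemma cond_mean_cong: "(\<And>i. i \<le> k \<Longrightarrow> x i = x' i) \<Longrightarrow> cond_mean k f x = cond_mean k f x'"
  using resample_cong[of k x x'] by (simp add: cond_mean_def)

lemma cond_mean_0: "x \<in> space Q \<Longrightarrow> cond_mean 0 f x = (\<integral>y. f y \<partial>Q)"
  by (auto simp: cond_mean_def resample_0 intro: Bochner_Integration.integral_cong)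

lemma cond_mean_full:
  assumes "x \<in> space Q"
  shows "cond_mean N f x = f x"
proof -
  have "cond_mean N f x = (\<integral>y. f x \<partial>Q)"
    unfolding cond_mean_def
    by (rule Bochner_Integration.integral_cong) (use assms in \<open>auto simp: resample_full\<close>)
  then show ?thesis by (simp add: Q.prob_space)
qed

lemma cond_mean_measurable:
  assumes f: "f \<in> borel_measurable Q"
  shows "cond_mean k f \<in> borel_measurable Q"
proof -
  have "(\<lambda>(x, y). f (resample k x y)) \<in> borel_measurable (Q \<Otimes>\<^sub>M Q)"
    using measurable_compose[OF measurable_resample_pair f] by (simp add: case_prod_beta')
  then have "(\<lambda>x. \<integral>y. f (resample k x y) \<partial>Q) \<in> borel_measurable Q"
    by (rule Q.borel_measurable_lebesgue_integral)
  then show ?thesis by (simp add: cond_mean_def[abs_def])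
qed

context
  fixes f :: "(nat \<Rightarrow> 'b) \<Rightarrow> real" and K :: real
  assumes f: "f \<in> borel_measurable Q" and bd: "\<And>x. x \<in> space Q \<Longrightarrow> \<bar>f x\<bar> \<le> K"
begin

lemma integrable_resample:
  "x \<in> space Q \<Longrightarrow> integrable Q (\<lambda>y. f (resample k x y))"
  using measurable_compose[OF measurable_resample f] bd resample_in_space
  by (intro integrable_bounded[where K = K]) auto

lemma cond_mean_bounded:
  assumes x: "x \<in> space Q"
  shows "\<bar>cond_mean k f x\<bar> \<le> K"
proof -
  have "\<bar>cond_mean k f x\<bar> \<le> (\<integral>y. \<bar>f (resample k x y)\<bar> \<partial>Q)"
    unfolding cond_mean_def by (rule integral_abs_bound)
  also have "\<dots> \<le> (\<integral>y. K \<partial>Q)"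
    using integrable_resample[OF x] bd resample_in_space[OF x] by (intro integral_mono) auto
  finally show ?thesis by (simp add: Q.prob_space)
qed

text \<open>The martingale property: once \<open>z\<close> sits in the averaged point, integrating
  over \<open>z\<close> and \<open>y\<close> together is a single average over
  \<open>Q\<close>.\<close>

lemma cond_mean_tower:
  assumes k: "k \<in> {1..N}" and x: "x \<in> space Q"
  shows "(\<integral>z. cond_mean k f (x(k := z)) \<partial>P k) = cond_mean (k - 1) f x"
proof -
  have "(\<integral>z. cond_mean k f (x(k := z)) \<partial>P k)
      = (\<integral>z. (\<integral>y. f (resample (k - 1) x (y(k := z))) \<partial>Q) \<partial>P k)"
    using k by (simp add: cond_mean_def resample_fun_upd)
  also have "\<dots> = (\<integral>y. f (resample (k - 1) x y) \<partial>Q)"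
    using measurable_compose[OF measurable_resample[OF x] f] bd resample_in_space[OF x]
    by (intro integral_fun_upd(2)[OF k, symmetric]) auto
  finally show ?thesis by (simp add: cond_mean_def)
qed

lemma integral_cond_mean:
  assumes "k \<le> N"
  shows "(\<integral>x. cond_mean k f x \<partial>Q) = (\<integral>x. f x \<partial>Q)"
  using assms
proof (induction k)
  case 0
  have "(\<integral>x. cond_mean 0 f x \<partial>Q) = (\<integral>x. (\<integral>y. f y \<partial>Q) \<partial>Q)"
    by (rule Bochner_Integration.integral_cong) (auto simp: cond_mean_0)
  then show ?case by (simp add: Q.prob_space)
next
  case (Suc k)
  then have k: "Suc k \<in> {1..N}" by simp
  have "(\<integral>x. cond_mean (Suc k) f x \<partial>Q) = (\<integral>x. (\<integral>z. cond_mean (Suc k) f (x(Suc k := z)) \<partial>P (Suc k)) \<partial>Q)"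
    by (rule integral_fun_upd(1)[OF k cond_mean_measurable[OF f] cond_mean_bounded])
  also have "\<dots> = (\<integral>x. cond_mean k f x \<partial>Q)"
    by (rule Bochner_Integration.integral_cong) (use cond_mean_tower[OF k] in auto)
  finally show ?case using Suc by simp
qed

end

section \<open>The Azuma--Hoeffding inequality\<close>

text \<open>Each induction step integrates out the newest coordinate. Earlier differences do not
  depend on it, and Hoeffding's lemma bounds the remaining factor uniformly in the past.\<close>

lemma azuma_exp_moment:
  fixes D :: "nat \<Rightarrow> (nat \<Rightarrow> 'b) \<Rightarrow> real" and C :: "nat \<Rightarrow> real" and l :: real
  assumes l: "0 < l"
    and meas: "\<And>k. k \<in> {1..N} \<Longrightarrow> D k \<in> borel_measurable Q"
    and bound: "\<And>k x. \<lbrakk>k \<in> {1..N}; x \<in> space Q\<rbrakk> \<Longrightarrow> \<bar>D k x\<bar> \<le> C k"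
    and adapted: "\<And>k x y. (\<And>i. i \<le> k \<Longrightarrow> x i = y i) \<Longrightarrow> D k x = D k y"
    and centered: "\<And>k x. \<lbrakk>k \<in> {1..N}; x \<in> space Q\<rbrakk> \<Longrightarrow> (\<integral>z. D k (x(k := z)) \<partial>P k) = 0"
    and "n \<le> N"
  shows "(\<integral>\<^sup>+x. ennreal (exp (l * (\<Sum>k\<in>{1..n}. D k x))) \<partial>Q)
    \<le> ennreal (exp (l\<^sup>2 * (\<Sum>k\<in>{1..n}. (C k)\<^sup>2) / 2))"
  using \<open>n \<le> N\<close>
proof (induction n)
  case 0
  then show ?case by (simp add: Q.emeasure_space_1)
next
  case (Suc n)
  let ?k = "Suc n"
  have k: "?k \<in> {1..N}" using Suc.prems by simp
  define S where "S = (\<lambda>m x. \<Sum>j\<in>{1..m}. D j x)"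
  have S_meas: "S m \<in> borel_measurable Q" if "m \<le> N" for m
    unfolding S_def using that by (intro borel_measurable_sum meas) auto
  have S_upd: "S n (x(?k := z)) = S n x" for x z
    unfolding S_def by (intro sum.cong adapted) auto
  have hoeffding: "(\<integral>\<^sup>+z. ennreal (exp (l * D ?k (x(?k := z)))) \<partial>P ?k)
      \<le> ennreal (exp (l\<^sup>2 * (C ?k)\<^sup>2 / 2))" if x: "x \<in> space Q" for x
  proof -
    interpret R: interval_bounded_random_variable "P ?k" "\<lambda>z. D ?k (x(?k := z))" "- C ?k" "C ?k"
    proof
      show "(\<lambda>z. D ?k (x(?k := z))) \<in> borel_measurable (P ?k)"
        by (rule measurable_compose[OF measurable_fun_upd_component[OF k x] meas[OF k]])
      show "AE z in P ?k. D ?k (x(?k := z)) \<in> {- C ?k..C ?k}"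
      proof (rule AE_I2)
        fix z assume "z \<in> space (P ?k)"
        from bound[OF k fun_upd_in_space[OF k x this]]
        show "D ?k (x(?k := z)) \<in> {- C ?k..C ?k}" by (simp add: abs_le_iff)
      qed
    qed
    \<comment> \<open>The interval has length \<open>2 * C ?k\<close>, which turns the 1/8 of
      Hoeffding's lemma into 1/2.\<close>
    have "l\<^sup>2 * (C ?k - - C ?k)\<^sup>2 / 8 = l\<^sup>2 * (C ?k)\<^sup>2 / 2"
      by (simp add: power2_eq_square)
    then show ?thesis
      using R.Hoeffdings_lemma_nn_integral_0[OF l centered[OF k x]] by simp
  qed
  have "(\<integral>\<^sup>+x. ennreal (exp (l * S ?k x)) \<partial>Q)
      = (\<integral>\<^sup>+x. (\<integral>\<^sup>+z. ennreal (exp (l * S ?k (x(?k := z)))) \<partial>P ?k) \<partial>Q)"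
    using S_meas[of ?k] k by (intro nn_integral_fun_upd) auto
  also have "\<dots> = (\<integral>\<^sup>+x. ennreal (exp (l * S n x)) * (\<integral>\<^sup>+z. ennreal (exp (l * D ?k (x(?k := z)))) \<partial>P ?k) \<partial>Q)"
  proof (rule nn_integral_cong)
    fix x assume x: "x \<in> space Q"
    have "(\<lambda>z. D ?k (x(?k := z))) \<in> borel_measurable (P ?k)"
      by (rule measurable_compose[OF measurable_fun_upd_component[OF k x] meas[OF k]])
    moreover have "S ?k (x(?k := z)) = S n x + D ?k (x(?k := z))" for z
      using S_upd[of x z] by (simp add: S_def)
    ultimately show "(\<integral>\<^sup>+z. ennreal (exp (l * S ?k (x(?k := z)))) \<partial>P ?k)
        = ennreal (exp (l * S n x)) * (\<integral>\<^sup>+z. ennreal (exp (l * D ?k (x(?k := z)))) \<partial>P ?k)"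
      by (simp add: distrib_left exp_add ennreal_mult nn_integral_cmult)
  qed
  also have "\<dots> \<le> (\<integral>\<^sup>+x. ennreal (exp (l * S n x)) * ennreal (exp (l\<^sup>2 * (C ?k)\<^sup>2 / 2)) \<partial>Q)"
    by (intro nn_integral_mono mult_left_mono hoeffding) auto
  also have "\<dots> = (\<integral>\<^sup>+x. ennreal (exp (l * S n x)) \<partial>Q) * ennreal (exp (l\<^sup>2 * (C ?k)\<^sup>2 / 2))"
    using S_meas[of n] Suc.prems by (intro nn_integral_multc) auto
  also have "\<dots> \<le> ennreal (exp (l\<^sup>2 * (\<Sum>j\<in>{1..n}. (C j)\<^sup>2) / 2)) * ennreal (exp (l\<^sup>2 * (C ?k)\<^sup>2 / 2))"
    using Suc by (intro mult_right_mono) (auto simp: S_def)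
  also have "\<dots> = ennreal (exp (l\<^sup>2 * (\<Sum>j\<in>{1..?k}. (C j)\<^sup>2) / 2))"
    by (simp add: ennreal_mult[symmetric] exp_add[symmetric] distrib_left add_divide_distrib)
  finally show ?case by (simp add: S_def)
qed

text \<open>Chernoff's method: Markov's inequality for the exponential of the sum, then the moment
  bound, with \<open>le_exp_tailI\<close> choosing \<open>l\<close>.\<close>

lemma azuma:
  fixes D :: "nat \<Rightarrow> (nat \<Rightarrow> 'b) \<Rightarrow> real" and C :: "nat \<Rightarrow> real"
  assumes meas: "\<And>k. k \<in> {1..N} \<Longrightarrow> D k \<in> borel_measurable Q"
    and bound: "\<And>k x. \<lbrakk>k \<in> {1..N}; x \<in> space Q\<rbrakk> \<Longrightarrow> \<bar>D k x\<bar> \<le> C k"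
    and adapted: "\<And>k x y. (\<And>i. i \<le> k \<Longrightarrow> x i = y i) \<Longrightarrow> D k x = D k y"
    and centered: "\<And>k x. \<lbrakk>k \<in> {1..N}; x \<in> space Q\<rbrakk> \<Longrightarrow> (\<integral>z. D k (x(k := z)) \<partial>P k) = 0"
    and t: "0 \<le> t"
  shows "measure Q {x \<in> space Q. t \<le> (\<Sum>k\<in>{1..N}. D k x)} \<le> exp_tail (\<Sum>k\<in>{1..N}. (C k)\<^sup>2) t"
proof (rule le_exp_tailI)
  fix l :: real assume l: "0 < l"
  define S where "S = (\<lambda>x. \<Sum>k\<in>{1..N}. D k x)"
  have S: "S \<in> borel_measurable Q"
    unfolding S_def by (intro borel_measurable_sum meas)
  have "emeasure Q {x \<in> space Q. t \<le> S x}
      \<le> ennreal (exp (- l * t)) * (\<integral>\<^sup>+x\<in>space Q. ennreal (exp (l * S x)) \<partial>Q)"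
    using S by (intro Chernoff_ineq_nn_integral_ge l) auto
  also have "(\<integral>\<^sup>+x\<in>space Q. ennreal (exp (l * S x)) \<partial>Q) = (\<integral>\<^sup>+x. ennreal (exp (l * S x)) \<partial>Q)"
    by (intro nn_integral_cong) auto
  also have "ennreal (exp (- l * t)) * \<dots>
      \<le> ennreal (exp (- l * t)) * ennreal (exp (l\<^sup>2 * (\<Sum>k\<in>{1..N}. (C k)\<^sup>2) / 2))"
    unfolding S_def
    by (intro mult_left_mono azuma_exp_moment l meas bound adapted centered) auto
  also have "\<dots> = ennreal (exp (l\<^sup>2 * (\<Sum>k\<in>{1..N}. (C k)\<^sup>2) / 2 - l * t))"
    by (simp add: ennreal_mult[symmetric] exp_add[symmetric])
  finally show "measure Q {x \<in> space Q. t \<le> (\<Sum>k\<in>{1..N}. D k x)}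
      \<le> exp (l\<^sup>2 * (\<Sum>k\<in>{1..N}. (C k)\<^sup>2) / 2 - l * t)"
    by (simp add: Q.emeasure_eq_measure S_def)
qed (use t in \<open>auto intro: sum_nonneg\<close>)

section \<open>Consequences of typical bounded differences\<close>

text \<open>Any \<open>x\<close> is reached from one fixed \<open>y\<close> by replacing coordinates
  one at a time, and the steps add up to a bound uniform in \<open>x\<close>. The absolute value
  also covers negative \<open>d k\<close>, for which no two points differ only at
  \<open>k\<close>.\<close>

lemma bounded_differences_imp_bounded:
  assumes tbd: "typical_bounded_differences N P \<Gamma> f c d"
    and cd: "\<And>k. k \<in> {1..N} \<Longrightarrow> c k \<le> d k"
  obtains K where "\<And>x. x \<in> space Q \<Longrightarrow> \<bar>f x\<bar> \<le> K"
proof -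
  obtain y where y: "y \<in> space Q" using Q.not_empty by blast
  have step: "\<bar>f (u(k := z)) - f u\<bar> \<le> \<bar>d k\<bar>"
    if "k \<in> {1..N}" "u \<in> space Q" "z \<in> space (P k)" for k u z
  proof (cases "u k = z")
    case False
    then have "differ_only_at k (u(k := z)) u"
      by (auto simp: differ_only_at_def)
    then have "\<bar>f (u(k := z)) - f u\<bar> \<le> (if u(k := z) \<in> \<Gamma> then c k else d k)"
      using tbd that fun_upd_in_space[OF that] by (auto simp: typical_bounded_differences_def)
    then show ?thesis using cd[OF that(1)] by (auto split: if_splits)
  qed auto
  have "\<bar>f (resample n x y) - f y\<bar> \<le> (\<Sum>k\<in>{1..n}. \<bar>d k\<bar>)" if x: "x \<in> space Q" and "n \<le> N" for x n
    using \<open>n \<le> N\<close>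
  proof (induction n)
    case 0
    then show ?case using x y by (simp add: resample_0)
  next
    case (Suc n)
    let ?u = "resample n x y"
    have "x (Suc n) \<in> space (P (Suc n))" using x Suc.prems by (auto simp: space_PiM)
    then have "\<bar>f (?u(Suc n := x (Suc n))) - f ?u\<bar> \<le> \<bar>d (Suc n)\<bar>"
      using Suc.prems resample_in_space[OF x y] by (intro step) auto
    then have "\<bar>f (resample (Suc n) x y) - f ?u\<bar> \<le> \<bar>d (Suc n)\<bar>"
      by (simp add: resample_eq_fun_upd)
    then show ?case using Suc by simp
  qed
  from this[of _ N] have "\<bar>f x - f y\<bar> \<le> (\<Sum>k\<in>{1..N}. \<bar>d k\<bar>)" if "x \<in> space Q" for x
    using that y by (simp add: resample_full)
  then have "\<bar>f x\<bar> \<le> \<bar>f y\<bar> + (\<Sum>k\<in>{1..N}. \<bar>d k\<bar>)" if "x \<in> space Q" for x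
    using that by (smt (verit))
  then show ?thesis by (rule that)
qed

text \<open>A negative \<open>c k\<close> is possible: when \<open>\<Gamma>\<close> is nonempty it forces \<open>space (P k)\<close> to be a
  singleton, so that \<open>f\<close> does not vary in the \<open>k\<close>-th coordinate.\<close>

lemma fun_upd_diff_le:
  assumes tbd: "typical_bounded_differences N P \<Gamma> f c d"
    and ne: "\<Gamma> \<inter> space Q \<noteq> {}"
    and k: "k \<in> {1..N}" and u: "u \<in> space Q" and z: "z \<in> space (P k)"
  shows "\<bar>f (u(k := z)) - f u\<bar> \<le> (if c k < 0 then 0 else if u \<in> \<Gamma> then c k else max 0 (d k))"
proof (cases "u k = z")
  case True
  then show ?thesis by auto
next
  case False
  have tbd': "\<bar>f v - f w\<bar> \<le> (if v \<in> \<Gamma> then c k else d k)"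
    if "v \<in> space Q" "w \<in> space Q" "differ_only_at k v w" for v w
    using tbd k that by (auto simp: typical_bounded_differences_def)
  have "\<not> c k < 0"
  proof
    assume neg: "c k < 0"
    obtain v where v: "v \<in> \<Gamma>" "v \<in> space Q" using ne by auto
    have single: "v k = w" if w: "w \<in> space (P k)" for w
    proof (rule ccontr)
      assume "v k \<noteq> w"
      then have "differ_only_at k v (v(k := w))" by (auto simp: differ_only_at_def)
      from tbd'[OF v(2) fun_upd_in_space[OF k v(2) w] this] v(1) neg show False by auto
    qed
    have "u k \<in> space (P k)" using u k by (auto simp: space_PiM PiE_def Pi_def)
    from single[OF this] single[OF z] False show False by simp
  qed
  \<comment> \<open>The hypothesis tests \<open>\<Gamma>\<close> at its first point, so
    \<open>u\<close> comes first and the difference is flipped afterwards.\<close>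
  moreover have "differ_only_at k u (u(k := z))" using False by (auto simp: differ_only_at_def)
  from tbd'[OF u fun_upd_in_space[OF k u z] this]
  have "\<bar>f (u(k := z)) - f u\<bar> \<le> (if u \<in> \<Gamma> then c k else d k)"
    by (simp add: abs_minus_commute)
  ultimately show ?thesis by (auto split: if_splits)
qed

text \<open>Both means average over the same \<open>y\<close>, and membership in
  \<open>\<Gamma>\<close> is tested at \<open>resample (k - 1) x y\<close>. The chance of failure
  thus depends only on the first \<open>k - 1\<close> coordinates of \<open>x\<close>, which is what
  later makes the truncation predictable.\<close>

lemma martingale_difference_le:
  assumes tbd: "typical_bounded_differences N P \<Gamma> f c d"
    and cd: "\<And>k. k \<in> {1..N} \<Longrightarrow> c k \<le> d k"
    and f: "f \<in> borel_measurable Q" and \<Gamma>: "\<Gamma> \<in> sets Q" and ne: "\<Gamma> \<noteq> {}"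
    and k: "k \<in> {1..N}" and x: "x \<in> space Q"
    and typical: "cond_mean (k - 1) (indicator (space Q - \<Gamma>)) x \<le> g"
  shows "\<bar>cond_mean k f x - cond_mean (k - 1) f x\<bar> \<le> \<bar>c k + g * (d k - c k)\<bar>"
proof -
  obtain K where K: "\<And>x. x \<in> space Q \<Longrightarrow> \<bar>f x\<bar> \<le> K"
    using bounded_differences_imp_bounded[OF tbd cd] by blast
  let ?u = "\<lambda>y. resample (k - 1) x y"
  let ?b = "\<lambda>y. indicator (space Q - \<Gamma>) (?u y) :: real"
  have ne': "\<Gamma> \<inter> space Q \<noteq> {}" using ne sets.sets_into_space[OF \<Gamma>] by auto
  have xk: "x k \<in> space (P k)" using x k by (auto simp: space_PiM)
  have diff: "\<bar>f (resample k x y) - f (?u y)\<bar>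
      \<le> (if c k < 0 then 0 else if ?u y \<in> \<Gamma> then c k else max 0 (d k))" if "y \<in> space Q" for y
    using fun_upd_diff_le[OF tbd ne' k resample_in_space[OF x that] xk] k
    by (simp add: resample_eq_fun_upd)
  have int_f: "integrable Q (\<lambda>y. f (resample j x y))" for j
    by (rule integrable_resample[OF f K x])
  have int_b: "integrable Q ?b"
    by (rule integrable_resample[of _ 1, OF _ _ x]) (use \<Gamma> in auto)
  have "\<bar>cond_mean k f x - cond_mean (k - 1) f x\<bar> = \<bar>\<integral>y. f (resample k x y) - f (?u y) \<partial>Q\<bar>"
    unfolding cond_mean_def by (subst Bochner_Integration.integral_diff[OF int_f int_f]) simp
  also have "\<dots> \<le> (\<integral>y. \<bar>f (resample k x y) - f (?u y)\<bar> \<partial>Q)"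
    by (rule integral_abs_bound)
  also have "\<dots> \<le> \<bar>c k + g * (d k - c k)\<bar>"
  proof (cases "c k < 0")
    \<comment> \<open>Here \<open>f\<close> is constant in coordinate \<open>k\<close>. The absolute
      value in the bound matters because \<open>c k + g * (d k - c k)\<close> may be
      negative.\<close>
    case True
    have "(\<integral>y. \<bar>f (resample k x y) - f (?u y)\<bar> \<partial>Q) \<le> (\<integral>y. 0 \<partial>Q)"
      using int_f diff True by (intro integral_mono) auto
    then show ?thesis by simp
  next
    \<comment> \<open>With \<open>0 \<le> c k \<le> d k\<close> the two-case bound is affine in the
      indicator, so its mean involves only the conditional probability of leaving
      \<open>\<Gamma>\<close>.\<close>
    case False
    have "(\<integral>y. \<bar>f (resample k x y) - f (?u y)\<bar> \<partial>Q) \<le> (\<integral>y. c k + (d k - c k) * ?b y \<partial>Q)"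
    proof (rule integral_mono)
      fix y assume y: "y \<in> space Q"
      show "\<bar>f (resample k x y) - f (?u y)\<bar> \<le> c k + (d k - c k) * ?b y"
        using diff[OF y] False cd[OF k] resample_in_space[OF x y, of "k - 1"]
        by (auto simp: indicator_def split: if_splits)
    qed (use int_f int_b in auto)
    also have "\<dots> = c k + (d k - c k) * cond_mean (k - 1) (indicator (space Q - \<Gamma>)) x"
      using int_b by (simp add: cond_mean_def Q.prob_space)
    also have "\<dots> \<le> c k + (d k - c k) * g"
      using cd[OF k] typical by (intro add_left_mono mult_left_mono) auto
    finally show ?thesis by (simp add: mult.commute)
  qed
  finally show ?thesis .
qed

section \<open>The exceptional event and the tail bound\<close>

text \<open>Markov's inequality: the conditional probability of \<open>A\<close> is nonnegative, and
  its mean is \<open>measure Q A\<close> by \<open>integral_cond_mean\<close>.\<close>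

lemma measure_cond_mean_gt_le:
  assumes A: "A \<in> sets Q" and "k \<le> N" and g: "0 < g"
  shows "measure Q {x \<in> space Q. g < cond_mean k (indicator A) x} \<le> inverse g * measure Q A"
proof -
  have i: "(indicator A :: _ \<Rightarrow> real) \<in> borel_measurable Q" using A by simp
  have bd: "\<bar>indicator A x :: real\<bar> \<le> 1" for x by simp
  note m = cond_mean_measurable[OF i]
  have int: "integrable Q (cond_mean k (indicator A))"
    by (rule integrable_bounded[OF m cond_mean_bounded[OF i bd]])
  have "measure Q {x \<in> space Q. g < cond_mean k (indicator A) x}
      \<le> measure Q {x \<in> space Q. g \<le> cond_mean k (indicator A) x}"
    using m by (intro Q.finite_measure_mono) auto
  also have "\<dots> \<le> (\<integral>x. cond_mean k (indicator A) x \<partial>Q) / g"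
    by (intro integral_Markov_inequality_measure[where A = "{}"] int g)
      (auto simp: cond_mean_def)
  also have "\<dots> = inverse g * measure Q A"
    using integral_cond_mean[OF i bd \<open>k \<le> N\<close>] A by (simp add: field_simps)
  finally show ?thesis .
qed

theorem typical_bounded_differences_tail:
  assumes "1 \<le> N" and \<Gamma>: "\<Gamma> \<in> sets Q"
    and \<gamma>: "\<And>k. k \<in> {1..N} \<Longrightarrow> 0 < \<gamma> k \<and> \<gamma> k \<le> 1"
  obtains B where "B \<in> sets Q"
    and "measure Q B \<le> (\<Sum>k\<in>{1..N}. inverse (\<gamma> k)) * measure Q (space Q - \<Gamma>)"
    and "space Q - B \<subseteq> \<Gamma>"
    and "\<And>f c d t. \<lbrakk>f \<in> borel_measurable Q; \<And>k. k \<in> {1..N} \<Longrightarrow> c k \<le> d k;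
        typical_bounded_differences N P \<Gamma> f c d; 0 \<le> t\<rbrakk> \<Longrightarrow>
      measure Q {x \<in> space Q. (\<integral>x. f x \<partial>Q) + t \<le> f x \<and> x \<notin> B}
        \<le> exp_tail (\<Sum>k\<in>{1..N}. (c k + \<gamma> k * (d k - c k))\<^sup>2) t"
proof -
  let ?bad = "space Q - \<Gamma>"
  have bad: "?bad \<in> sets Q" using \<Gamma> by auto
  \<comment> \<open>The hypothesis \<open>\<gamma> k \<le> 1\<close> enters here: it lets the first
    summand pay for the complement of \<open>\<Gamma>\<close> inside \<open>B\<close>, and it
    settles empty \<open>\<Gamma>\<close>.\<close>
  have inv_ge_1: "1 \<le> inverse (\<gamma> k)" if "k \<in> {1..N}" for k
    using \<gamma>[OF that] by (simp add: one_le_inverse)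
  show ?thesis
  \<comment> \<open>At \<open>k = 1\<close> nothing is conditioned on, so the failure probability is
    the constant \<open>measure Q ?bad\<close>. If it exceeds \<open>\<gamma> 1\<close>, the allowed
    bound is at least 1 and the whole space serves as \<open>B\<close>. Empty
    \<open>\<Gamma>\<close> joins this case, since the difference estimate needs a point of
    \<open>\<Gamma>\<close>.\<close>
  proof (cases "\<gamma> 1 < measure Q ?bad \<or> \<Gamma> = {}")
    case True
    have "1 \<le> inverse (\<gamma> 1) * measure Q ?bad"
    proof (cases "\<Gamma> = {}")
      case True
      then show ?thesis using inv_ge_1[of 1] \<open>1 \<le> N\<close> by (simp add: Q.prob_space)
    next
      case False
      then show ?thesis using \<open>_ \<or> _\<close> \<gamma>[of 1] \<open>1 \<le> N\<close> by (simp add: field_simps)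
    qed
    also have "\<dots> \<le> (\<Sum>k\<in>{1..N}. inverse (\<gamma> k)) * measure Q ?bad"
      using \<open>1 \<le> N\<close> \<gamma> by (intro mult_right_mono member_le_sum) (auto intro: less_imp_le)
    finally have le: "1 \<le> (\<Sum>k\<in>{1..N}. inverse (\<gamma> k)) * measure Q ?bad" .
    show ?thesis
    proof (rule that[of "space Q"])
      fix f :: "(nat \<Rightarrow> 'b) \<Rightarrow> real" and c d :: "nat \<Rightarrow> real" and t :: real
      have empty: "{x \<in> space Q. (\<integral>x. f x \<partial>Q) + t \<le> f x \<and> x \<notin> space Q} = {}" by auto
      show "measure Q {x \<in> space Q. (\<integral>x. f x \<partial>Q) + t \<le> f x \<and> x \<notin> space Q}
          \<le> exp_tail (\<Sum>k\<in>{1..N}. (c k + \<gamma> k * (d k - c k))\<^sup>2) t"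
        unfolding empty by (simp add: exp_tail_def)
    qed (use le in \<open>auto simp: Q.prob_space\<close>)
  next
    case False
    then have ne: "\<Gamma> \<noteq> {}" and first: "measure Q ?bad \<le> \<gamma> 1" by auto
    let ?p = "\<lambda>k. cond_mean (k - 1) (indicator ?bad)"
    have p_meas: "?p k \<in> borel_measurable Q" for k
      using bad by (intro cond_mean_measurable) auto
    \<comment> \<open>By \<open>first\<close> no exceptional event is needed at \<open>k = 1\<close>. Its slot holds the complement of
      \<open>\<Gamma>\<close>, so that the union bound does not exceed the sum of the \<open>inverse (\<gamma> k)\<close>.\<close>
    define U where "U k = (if k = 1 then ?bad else {x \<in> space Q. \<gamma> k < ?p k x})" for k
    define B where "B = (\<Union>k\<in>{1..N}. U k)"
    have U: "U k \<in> sets Q" for k using bad p_meas[of k] by (auto simp: U_def)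
    have U_le: "measure Q (U k) \<le> inverse (\<gamma> k) * measure Q ?bad" if k: "k \<in> {1..N}" for k
    proof (cases "k = 1")
      case True
      then show ?thesis
        using mult_right_mono[OF inv_ge_1[OF k], of "measure Q ?bad"] by (simp add: U_def)
    next
      case False
      then show ?thesis
        using k \<gamma>[OF k] bad by (auto simp: U_def intro: measure_cond_mean_gt_le)
    qed
    have typical: "?p k x \<le> \<gamma> k" if "x \<in> space Q" "x \<notin> B" "k \<in> {1..N}" for x k
    proof (cases "k = 1")
      case True
      then show ?thesis using first that bad by (simp add: cond_mean_0)
    next
      case False
      then show ?thesis using that by (force simp: B_def U_def)
    qed
    show ?thesis
    proof (rule that[of B])
      show "B \<in> sets Q" using U by (auto simp: B_def)
      have "measure Q B \<le> (\<Sum>k\<in>{1..N}. measure Q (U k))"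
        unfolding B_def using U by (intro Q.finite_measure_subadditive_finite) auto
      also have "\<dots> \<le> (\<Sum>k\<in>{1..N}. inverse (\<gamma> k) * measure Q ?bad)"
        by (intro sum_mono U_le)
      finally show "measure Q B \<le> (\<Sum>k\<in>{1..N}. inverse (\<gamma> k)) * measure Q ?bad"
        by (simp add: sum_distrib_right)
      show "space Q - B \<subseteq> \<Gamma>"
        using \<open>1 \<le> N\<close> by (force simp: B_def U_def)
    next
      fix f :: "(nat \<Rightarrow> 'b) \<Rightarrow> real" and c d :: "nat \<Rightarrow> real" and t :: real
      assume f: "f \<in> borel_measurable Q" and cd: "\<And>k. k \<in> {1..N} \<Longrightarrow> c k \<le> d k"
        and tbd: "typical_bounded_differences N P \<Gamma> f c d" and t: "0 \<le> t"
      obtain K where K: "\<And>x. x \<in> space Q \<Longrightarrow> \<bar>f x\<bar> \<le> K"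
        using bounded_differences_imp_bounded[OF tbd cd] by blast
      \<comment> \<open>Azuma needs bounds on absolute differences even when \<open>c k\<close> is
        negative; the squares are unaffected by the absolute value.\<close>
      define C where "C k = \<bar>c k + \<gamma> k * (d k - c k)\<bar>" for k
      define D where "D k x = (if k \<in> {1..N} \<and> ?p k x \<le> \<gamma> k
        then cond_mean k f x - cond_mean (k - 1) f x else 0)" for k x
      have "{x \<in> space Q. (\<integral>x. f x \<partial>Q) + t \<le> f x \<and> x \<notin> B}
          \<subseteq> {x \<in> space Q. t \<le> (\<Sum>k\<in>{1..N}. D k x)}"
      proof clarify
        fix x assume x: "x \<in> space Q" "x \<notin> B" and ge: "(\<integral>x. f x \<partial>Q) + t \<le> f x"
        \<comment> \<open>Outside \<open>B\<close> every \<open>?p k x\<close> is at most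
          \<open>\<gamma> k\<close>, so nothing is truncated and the sum telescopes.\<close>
        have "(\<Sum>k\<in>{1..N}. D k x) = (\<Sum>k\<in>{1..N}. cond_mean k f x - cond_mean (k - 1) f x)"
          by (intro sum.cong) (use typical[OF x] in \<open>auto simp: D_def\<close>)
        also have "\<dots> = cond_mean N f x - cond_mean 0 f x"
          using sum_telescope''[of 0 N "\<lambda>k. cond_mean k f x"] by (simp add: One_nat_def)
        finally show "t \<le> (\<Sum>k\<in>{1..N}. D k x)"
          using x(1) ge by (simp add: cond_mean_0 cond_mean_full)
      qed
      moreover have D_meas: "D k \<in> borel_measurable Q" for k
      proof -
        note [measurable] = p_meas[of k] cond_mean_measurable[OF f]
        show ?thesis unfolding D_def[abs_def] by measurable
      qed
      ultimately have "measure Q {x \<in> space Q. (\<integral>x. f x \<partial>Q) + t \<le> f x \<and> x \<notin> B}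
          \<le> measure Q {x \<in> space Q. t \<le> (\<Sum>k\<in>{1..N}. D k x)}"
        by (intro Q.finite_measure_mono) auto
      also have "\<dots> \<le> exp_tail (\<Sum>k\<in>{1..N}. (C k)\<^sup>2) t"
      proof (rule azuma[OF D_meas _ _ _ t])
        show "\<bar>D k x\<bar> \<le> C k" if "k \<in> {1..N}" "x \<in> space Q" for k x
          using martingale_difference_le[OF tbd cd f \<Gamma> ne that] by (auto simp: D_def C_def)
        show "D k x = D k y" if eq: "\<And>i. i \<le> k \<Longrightarrow> x i = y i" for k x y
        proof -
          have "cond_mean j h x = cond_mean j h y" if "j \<le> k" for j h
            using that eq by (intro cond_mean_cong) auto
          then show ?thesis by (simp add: D_def)
        qed
        show "(\<integral>z. D k (x(k := z)) \<partial>P k) = 0" if k: "k \<in> {1..N}" and x: "x \<in> space Q" for k x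
        proof -
          \<comment> \<open>Neither the truncation test nor the previous mean sees coordinate
            \<open>k\<close>. As a function of \<open>z\<close> the difference is therefore
            identically 0 or \<open>cond_mean k f\<close> minus its own average.\<close>
          have past: "cond_mean (k - 1) h (x(k := z)) = cond_mean (k - 1) h x" for h z
            using k by (intro cond_mean_cong) auto
          have "integrable (P k) (\<lambda>z. cond_mean k f (x(k := z)))"
            using measurable_compose[OF measurable_fun_upd_component[OF k x] cond_mean_measurable[OF f]]
              cond_mean_bounded[OF f K] fun_upd_in_space[OF k x]
            by (intro M.integrable_const_bound[where B = K]) auto
          then have "(\<integral>z. cond_mean k f (x(k := z)) - cond_mean (k - 1) f x \<partial>P k) = 0"
            using cond_mean_tower[OF f K k x] by (simp add: M.prob_space)
          then show ?thesis using k by (cases "?p k x \<le> \<gamma> k") (simp_all add: D_def past)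
        qed
      qed
      finally show "measure Q {x \<in> space Q. (\<integral>x. f x \<partial>Q) + t \<le> f x \<and> x \<notin> B}
          \<le> exp_tail (\<Sum>k\<in>{1..N}. (c k + \<gamma> k * (d k - c k))\<^sup>2) t"
        by (simp add: C_def)
    qed
  qed
qed

end

section \<open>Transfer to independent random variables\<close>

theorem theorem2:
  fixes M :: "'a measure" and N :: nat
    and L :: "nat \<Rightarrow> 'b measure"
    and X :: "nat \<Rightarrow> 'a \<Rightarrow> 'b"
    and \<Gamma> :: "(nat \<Rightarrow> 'b) set"
    and \<gamma> :: "nat \<Rightarrow> real"
  assumes "prob_space M"
    and "1 \<le> N"
    and "prob_space.indep_vars M L X {1..N}"
    and "\<Gamma> \<in> sets (PiM {1..N} L)"
    and "\<And>k. k \<in> {1..N} \<Longrightarrow> 0 < \<gamma> k \<and> \<gamma> k \<le> 1"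
  shows "\<exists>B \<in> sets (PiM {1..N} L).
      measure M {\<omega> \<in> space M. joint N X \<omega> \<in> B}
        \<le> (\<Sum>k\<in>{1..N}. inverse (\<gamma> k)) * measure M {\<omega> \<in> space M. joint N X \<omega> \<notin> \<Gamma>} \<and>
      space (PiM {1..N} L) - B \<subseteq> \<Gamma> \<and>
      (\<forall>f \<in> borel_measurable (PiM {1..N} L). \<forall>c d :: nat \<Rightarrow> real.
        (\<forall>k\<in>{1..N}. c k \<le> d k) \<longrightarrow>
        typical_bounded_differences N L \<Gamma> f c d \<longrightarrow>
        (let \<mu> = integral\<^sup>L M (\<lambda>\<omega>. f (joint N X \<omega>));
             e = (\<lambda>k. \<gamma> k * (d k - c k))
         in \<forall>t\<ge>0.
           measure M {\<omega> \<in> space M. f (joint N X \<omega>) \<ge> \<mu> + t \<and> joint N X \<omega> \<notin> B}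
             \<le> exp_tail (\<Sum>k\<in>{1..N}. (c k + e k)\<^sup>2) t))"
proof -
  interpret \<Omega>: prob_space M by fact
  have X: "X k \<in> measurable M (L k)" if "k \<in> {1..N}" for k
    using assms(3) that by (auto simp: \<Omega>.indep_vars_def)
  \<comment> \<open>The locale wants a probability measure at every index, also outside \<open>{1..N}\<close>.\<close>
  define \<pi> where "\<pi> k = (if k \<in> {1..N} then k else 1)" for k
  define P where "P k = distr M (L (\<pi> k)) (X (\<pi> k))" for k
  have \<pi>: "\<pi> k \<in> {1..N}" for k using \<open>1 \<le> N\<close> by (simp add: \<pi>_def)
  have P: "prob_space (P k)" for k
    unfolding P_def by (rule \<Omega>.prob_space_distr[OF X[OF \<pi>]])
  interpret product_prob_seq P N
    by (rule product_prob_seq.intro) (rule P)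
  have sets_Q: "sets Q = sets (PiM {1..N} L)"
    by (intro sets_PiM_cong) (auto simp: P_def \<pi>_def)
  have space_Q: "space Q = space (PiM {1..N} L)"
    by (rule sets_eq_imp_space_eq[OF sets_Q])
  have joint: "joint N X \<in> measurable M (PiM {1..N} L)"
    unfolding joint_def[abs_def] using X by (intro measurable_restrict)
  \<comment> \<open>Independence says that the joint law is the product of the marginals;
    \<open>1 \<le> N\<close> makes the index set nonempty, as this characterisation
    requires.\<close>
  have "distr M (PiM {1..N} L) (joint N X) = (\<Pi>\<^sub>M k\<in>{1..N}. distr M (L k) (X k))"
    using assms(3) \<Omega>.indep_vars_iff_distr_eq_PiM'[OF _ X, of "{1..N}" "\<lambda>k. k"] \<open>1 \<le> N\<close>
    by (simp add: joint_def[abs_def])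
  also have "\<dots> = Q" by (intro PiM_cong) (auto simp: P_def \<pi>_def)
  finally have Q: "Q = distr M (PiM {1..N} L) (joint N X)" by simp
  have measure_Q: "measure Q {x \<in> space Q. R x} = measure M {\<omega> \<in> space M. R (joint N X \<omega>)}"
    if "{x \<in> space Q. R x} \<in> sets Q" for R
  proof -
    have "measure Q {x \<in> space Q. R x}
        = measure M (joint N X -` {x \<in> space Q. R x} \<inter> space M)"
      using that joint by (subst Q, subst measure_distr) (auto simp: sets_Q)
    also have "joint N X -` {x \<in> space Q. R x} \<inter> space M = {\<omega> \<in> space M. R (joint N X \<omega>)}"
      using measurable_space[OF joint] by (auto simp: space_Q)
    finally show ?thesis .
  qed
  have \<Gamma>: "\<Gamma> \<in> sets Q" using assms(4) by (simp add: sets_Q)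
  show ?thesis
  proof (rule typical_bounded_differences_tail[OF \<open>1 \<le> N\<close> \<Gamma> assms(5)])
    fix B assume B: "B \<in> sets Q"
        "measure Q B \<le> (\<Sum>k\<in>{1..N}. inverse (\<gamma> k)) * measure Q (space Q - \<Gamma>)"
        "space Q - B \<subseteq> \<Gamma>"
      and tail: "\<And>f c d t. \<lbrakk>f \<in> borel_measurable Q; \<And>k. k \<in> {1..N} \<Longrightarrow> c k \<le> d k;
          typical_bounded_differences N P \<Gamma> f c d; 0 \<le> t\<rbrakk> \<Longrightarrow>
        measure Q {x \<in> space Q. (\<integral>x. f x \<partial>Q) + t \<le> f x \<and> x \<notin> B}
          \<le> exp_tail (\<Sum>k\<in>{1..N}. (c k + \<gamma> k * (d k - c k))\<^sup>2) t"
    show ?thesis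
    proof (intro bexI[of _ B] conjI ballI allI impI)
      show "B \<in> sets (PiM {1..N} L)" using B(1) by (simp add: sets_Q)
      have "{x \<in> space Q. x \<in> B} = B" using sets.sets_into_space[OF B(1)] by auto
      then have "measure Q B = measure M {\<omega> \<in> space M. joint N X \<omega> \<in> B}"
        using measure_Q[of "\<lambda>x. x \<in> B"] B(1) by simp
      moreover have "{x \<in> space Q. x \<notin> \<Gamma>} = space Q - \<Gamma>" by auto
      then have "measure Q (space Q - \<Gamma>) = measure M {\<omega> \<in> space M. joint N X \<omega> \<notin> \<Gamma>}"
        using measure_Q[of "\<lambda>x. x \<notin> \<Gamma>"] \<Gamma> by auto
      ultimately show "measure M {\<omega> \<in> space M. joint N X \<omega> \<in> B}
          \<le> (\<Sum>k\<in>{1..N}. inverse (\<gamma> k)) * measure M {\<omega> \<in> space M. joint N X \<omega> \<notin> \<Gamma>}"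
        using B(2) by simp
      show "space (PiM {1..N} L) - B \<subseteq> \<Gamma>" using B(3) by (simp add: space_Q)
    next
      fix f :: "(nat \<Rightarrow> 'b) \<Rightarrow> real" and c d :: "nat \<Rightarrow> real"
      assume f: "f \<in> borel_measurable (PiM {1..N} L)" and cd: "\<forall>k\<in>{1..N}. c k \<le> d k"
        and tbd: "typical_bounded_differences N L \<Gamma> f c d"
      have f': "f \<in> borel_measurable Q"
        using f measurable_cong_sets[OF sets_Q refl] by blast
      have tbd': "typical_bounded_differences N P \<Gamma> f c d"
        using tbd by (simp add: typical_bounded_differences_def space_Q)
      have mean: "(\<integral>x. f x \<partial>Q) = (\<integral>\<omega>. f (joint N X \<omega>) \<partial>M)"
        by (subst Q, rule integral_distr[OF joint f])
      have "measure M {\<omega> \<in> space M. (\<integral>\<omega>. f (joint N X \<omega>) \<partial>M) + t \<le> f (joint N X \<omega>) \<and> joint N X \<omega> \<notin> B}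
          \<le> exp_tail (\<Sum>k\<in>{1..N}. (c k + \<gamma> k * (d k - c k))\<^sup>2) t" if "0 \<le> t" for t
        using tail[OF f' _ tbd' that] cd B(1) f'
          measure_Q[of "\<lambda>x. (\<integral>\<omega>. f (joint N X \<omega>) \<partial>M) + t \<le> f x \<and> x \<notin> B"]
        by (simp add: mean)
      then show "let \<mu> = integral\<^sup>L M (\<lambda>\<omega>. f (joint N X \<omega>)); e = (\<lambda>k. \<gamma> k * (d k - c k))
        in \<forall>t\<ge>0. measure M {\<omega> \<in> space M. f (joint N X \<omega>) \<ge> \<mu> + t \<and> joint N X \<omega> \<notin> B}
               \<le> exp_tail (\<Sum>k\<in>{1..N}. (c k + e k)\<^sup>2) t"
        by (simp add: Let_def)
    qed
  qed
qed

end
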